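(* Let $M\xrightarrow{P}A$ be a relative averaging algebra and $(N\xrightarrow{Q}B,l,r)$ a bimodule over it. Then $M\oplus N\xrightarrow{P\oplus Q}A\oplus B$ is a relative averaging algebra, where $A\oplus B$ has the semidirect product $$(a,b)\cdot_\ltimes(a',b')=(a\cdot a',a\cdot_Bb'+b\cdot_Ba')$$ and $M\oplus N$ has the $(A\oplus B)$-bimodule structure $$(a,b)\triangleright(u,n)=(a\cdot_Mu,a\cdot_Nn+r(b,u)),\qquad(u,n)\triangleleft(a,b)=(u\cdot_Ma,l(u,b)+n\cdot_Na).$$
   Context: Vector spaces are over a field of characteristic $0$; associative algebras are not assumed unital. A relative averaging algebra $M\xrightarrow{P}A$ consists of an associative algebra $A$, an $A$-bimodule $M$ (both actions written $\cdot_M$) and a linear map $P:M\to A$ with $P(u)\cdot P(v)=P(P(u)\cdot_Mv)=P(u\cdot_MP(v))$ for all $u,v\in M$. A bimodule over $M\xrightarrow{P}A$ is a tuple $(N\xrightarrow{Q}B,l,r)$ where $N,B$ are $A$-bimodules, $Q:N\to B$ is a linear map, and $l:M\times B\to N$, $r:B\times M\to N$ are bilinear maps such that for $a\in A,b\in B,u\in M,n\in N$: $l(a\cdot_Mu,b)=a\cdot_Nl(u,b)$, $l(u\cdot_Ma,b)=l(u,a\cdot_Bb)$, $l(u,b\cdot_Ba)=l(u,b)\cdot_Na$; $r(a\cdot_Bb,u)=a\cdot_Nr(b,u)$, $r(b\cdot_Ba,u)=r(b,a\cdot_Mu)$, $r(b,u\cdot_Ma)=r(b,u)\cdot_Na$;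 $P(u)\cdot_BQ(n)=Q(P(u)\cdot_Nn)=Q(l(u,Q(n)))$; $Q(n)\cdot_BP(u)=Q(r(Q(n),u))=Q(n\cdot_NP(u))$. *)

theory Defs
  imports "HOL-Analysis.Product_Vector"
begin

text \<open>
  A vector space is a type of class \<open>ab_group_add\<close> together with a scalar multiplication
  by a field of characteristic zero. Algebras are not assumed to be unital or commutative.
\<close>

definition bilinear_map ::
  "('k::field \<Rightarrow> 'u::ab_group_add \<Rightarrow> 'u) \<Rightarrow> ('k \<Rightarrow> 'v::ab_group_add \<Rightarrow> 'v) \<Rightarrow>
   ('k \<Rightarrow> 'w::ab_group_add \<Rightarrow> 'w) \<Rightarrow> ('u \<Rightarrow> 'v \<Rightarrow> 'w) \<Rightarrow> bool" where
  "bilinear_map s1 s2 s3 f \<longleftrightarrow>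
     (\<forall>x. Vector_Spaces.linear s2 s3 (\<lambda>y. f x y)) \<and>
     (\<forall>y. Vector_Spaces.linear s1 s3 (\<lambda>x. f x y))"

locale assoc_algebra = vector_space sA
  for sA :: "'k::field_char_0 \<Rightarrow> 'a::ab_group_add \<Rightarrow> 'a" +
  fixes mult :: "'a \<Rightarrow> 'a \<Rightarrow> 'a"
  assumes mult_bilinear: "bilinear_map sA sA sA mult"
    and mult_assoc: "mult (mult a b) c = mult a (mult b c)"

locale algebra_bimodule = alg: assoc_algebra sA mult + vs: vector_space sM
  for sA :: "'k::field_char_0 \<Rightarrow> 'a::ab_group_add \<Rightarrow> 'a"
    and mult :: "'a \<Rightarrow> 'a \<Rightarrow> 'a"
    and sM :: "'k \<Rightarrow> 'm::ab_group_add \<Rightarrow> 'm" +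
  fixes lact :: "'a \<Rightarrow> 'm \<Rightarrow> 'm"
    and ract :: "'m \<Rightarrow> 'a \<Rightarrow> 'm"
  assumes lact_bilinear: "bilinear_map sA sM sM lact"
    and ract_bilinear: "bilinear_map sM sA sM ract"
    and lact_lact: "lact (mult a b) u = lact a (lact b u)"
    and lact_ract: "ract (lact a u) b = lact a (ract u b)"
    and ract_ract: "ract u (mult a b) = ract (ract u a) b"

locale relative_averaging_algebra = algebra_bimodule sA mult sM lact ract
  for sA :: "'k::field_char_0 \<Rightarrow> 'a::ab_group_add \<Rightarrow> 'a"
    and mult :: "'a \<Rightarrow> 'a \<Rightarrow> 'a"
    and sM :: "'k \<Rightarrow> 'm::ab_group_add \<Rightarrow> 'm"
    and lact :: "'a \<Rightarrow> 'm \<Rightarrow> 'm"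
    and ract :: "'m \<Rightarrow> 'a \<Rightarrow> 'm" +
  fixes P :: "'m \<Rightarrow> 'a"
  assumes P_linear: "Vector_Spaces.linear sM sA P"
    and P_lact: "mult (P u) (P v) = P (lact (P u) v)"
    and P_ract: "mult (P u) (P v) = P (ract u (P v))"

locale relative_averaging_bimodule =
  relative_averaging_algebra sA mult sM lM rM P +
  N: algebra_bimodule sA mult sN lN rN +
  B: algebra_bimodule sA mult sB lB rB
  for sA :: "'k::field_char_0 \<Rightarrow> 'a::ab_group_add \<Rightarrow> 'a"
    and mult :: "'a \<Rightarrow> 'a \<Rightarrow> 'a"
    and sM :: "'k \<Rightarrow> 'm::ab_group_add \<Rightarrow> 'm"
    and lM :: "'a \<Rightarrow> 'm \<Rightarrow> 'm"
    and rM :: "'m \<Rightarrow> 'a \<Rightarrow> 'm"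
    and P :: "'m \<Rightarrow> 'a"
    and sN :: "'k \<Rightarrow> 'n::ab_group_add \<Rightarrow> 'n"
    and lN :: "'a \<Rightarrow> 'n \<Rightarrow> 'n"
    and rN :: "'n \<Rightarrow> 'a \<Rightarrow> 'n"
    and sB :: "'k \<Rightarrow> 'b::ab_group_add \<Rightarrow> 'b"
    and lB :: "'a \<Rightarrow> 'b \<Rightarrow> 'b"
    and rB :: "'b \<Rightarrow> 'a \<Rightarrow> 'b" +
  fixes Q :: "'n \<Rightarrow> 'b"
    and l :: "'m \<Rightarrow> 'b \<Rightarrow> 'n"
    and r :: "'b \<Rightarrow> 'm \<Rightarrow> 'n"
  assumes Q_linear: "Vector_Spaces.linear sN sB Q"
    and l_bilinear: "bilinear_map sM sB sN l"
    and r_bilinear: "bilinear_map sB sM sN r"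
    and l_lM: "l (lM a u) b = lN a (l u b)"
    and l_rM: "l (rM u a) b = l u (lB a b)"
    and l_rB: "l u (rB b a) = rN (l u b) a"
    and r_lB: "r (lB a b) u = lN a (r b u)"
    and r_rB: "r (rB b a) u = r b (lM a u)"
    and r_rM: "r b (rM u a) = rN (r b u) a"
    and PQ_lN: "lB (P u) (Q n) = Q (lN (P u) n)"
    and PQ_l: "lB (P u) (Q n) = Q (l u (Q n))"
    and QP_r: "rB (Q n) (P u) = Q (r (Q n) u)"
    and QP_rN: "rB (Q n) (P u) = Q (rN n (P u))"

definition semidirect_mult ::
  "('a \<Rightarrow> 'a \<Rightarrow> 'a) \<Rightarrow> ('a \<Rightarrow> 'b \<Rightarrow> 'b) \<Rightarrow> ('b \<Rightarrow> 'a \<Rightarrow> 'b) \<Rightarrow>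
   'a \<times> 'b \<Rightarrow> 'a \<times> 'b \<Rightarrow> 'a \<times> 'b::ab_group_add" where
  "semidirect_mult mult lB rB =
     (\<lambda>(a, b) (a', b'). (mult a a', lB a b' + rB b a'))"

definition semidirect_lact ::
  "('a \<Rightarrow> 'm \<Rightarrow> 'm) \<Rightarrow> ('a \<Rightarrow> 'n \<Rightarrow> 'n) \<Rightarrow> ('b \<Rightarrow> 'm \<Rightarrow> 'n) \<Rightarrow>
   'a \<times> 'b \<Rightarrow> 'm \<times> 'n \<Rightarrow> 'm \<times> 'n::ab_group_add" where
  "semidirect_lact lM lN r =
     (\<lambda>(a, b) (u, n). (lM a u, lN a n + r b u))"

definition semidirect_ract ::
  "('m \<Rightarrow> 'a \<Rightarrow> 'm) \<Rightarrow> ('n \<Rightarrow> 'a \<Rightarrow> 'n) \<Rightarrow> ('m \<Rightarrow> 'b \<Rightarrow> 'n) \<Rightarrow>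
   'm \<times> 'n \<Rightarrow> 'a \<times> 'b \<Rightarrow> 'm \<times> 'n::ab_group_add" where
  "semidirect_ract rM rN l =
     (\<lambda>(u, n) (a, b). (rM u a, l u b + rN n a))"

end

theory Submission
  imports Defs
begin

text \<open>\<open>A \<oplus> B\<close> and \<open>M \<oplus> N\<close> are square-zero
  constructions: in any product, the second component is a sum of terms each containing exactly one
  entry from \<open>B\<close> or \<open>N\<close>. So every identity for the sums is the original
  identity in the first component, and in the second splits by the factor that supplies the entry
  from \<open>B\<close> or \<open>N\<close>. Each resulting identity is one axiom of the bimodule
  \<open>N\<close>, the bimodule \<open>B\<close>, or the maps \<open>l\<close>, \<open>r\<close>,
  \<open>Q\<close>. Bilinearity of all three products is the single lemma
  \<open>bilinear_map_prod\<close>.\<close>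

lemma bilinear_map_iff:
  "bilinear_map s1 s2 s3 f \<longleftrightarrow>
    vector_space s1 \<and> vector_space s2 \<and> vector_space s3 \<and>
    (\<forall>x y z. f x (y + z) = f x y + f x z) \<and> (\<forall>c x y. f x (s2 c y) = s3 c (f x y)) \<and>
    (\<forall>x y z. f (x + y) z = f x z + f y z) \<and> (\<forall>c x y. f (s1 c x) y = s3 c (f x y))"
  unfolding bilinear_map_def Vector_Spaces.linear_iff by blast

lemma prod_scale_apply:
  assumes "vector_space s1" "vector_space s2"
  shows "module_prod.scale s1 s2 c (x, y) = (s1 c x, s2 c y)"
proof -
  interpret vector_space_prod s1 s2
    using assms by (simp add: vector_space_prod_def vector_space_pair_def)
  show ?thesis
    by (rule scale_prod)
qed

lemma vector_space_prod_scale: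
  assumes "vector_space s1" "vector_space s2"
  shows "vector_space (module_prod.scale s1 s2)"
proof -
  interpret vector_space_prod s1 s2
    using assms by (simp add: vector_space_prod_def vector_space_pair_def)
  show ?thesis
    by (rule p.vector_space_axioms)
qed

lemma linear_map_prod:
  assumes "Vector_Spaces.linear s1 t1 f" and "Vector_Spaces.linear s2 t2 g"
  shows "Vector_Spaces.linear (module_prod.scale s1 s2) (module_prod.scale t1 t2) (map_prod f g)"
  using assms by (auto simp: Vector_Spaces.linear_iff vector_space_prod_scale prod_scale_apply)

text \<open>
  The semidirect product and both of its actions on \<open>M \<oplus> N\<close> are instances of this one shape.
\<close>

lemma bilinear_map_prod:
  assumes "bilinear_map s1 t1 w1 f" and "bilinear_map s1 t2 w2 g" and "bilinear_map s2 t1 w2 h"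
  shows "bilinear_map (module_prod.scale s1 s2) (module_prod.scale t1 t2) (module_prod.scale w1 w2)
    (\<lambda>(x, y) (x', y'). (f x x', g x y' + h y x'))"
proof -
  \<comment> \<open>Homogeneity in the second component means pulling a scalar out of a sum of two
    values in the target of \<open>g\<close> and \<open>h\<close>.\<close>
  interpret w2: vector_space w2
    using assms(2) by (simp add: bilinear_map_iff)
  show ?thesis
    using assms
    by (auto simp: bilinear_map_iff vector_space_prod_scale prod_scale_apply w2.scale_right_distrib)
qed

text \<open>The three positions of the module entry in a triple product correspond to the three
  axioms \<open>lact_lact\<close>, \<open>lact_ract\<close> and \<open>ract_ract\<close>. The
  general bimodule here is later taken to be \<open>B\<close>.\<close>

lemma (in algebra_bimodule) semidirect_assoc_algebra:
  "assoc_algebra (module_prod.scale sA sM) (semidirect_mult mult lact ract)"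
proof (intro assoc_algebra.intro assoc_algebra_axioms.intro)
  show "vector_space (module_prod.scale sA sM)"
    by (intro vector_space_prod_scale alg.vector_space_axioms vs.vector_space_axioms)
  show "bilinear_map (module_prod.scale sA sM) (module_prod.scale sA sM) (module_prod.scale sA sM)
      (semidirect_mult mult lact ract)"
    unfolding semidirect_mult_def
    by (intro bilinear_map_prod alg.mult_bilinear lact_bilinear ract_bilinear)
  show "semidirect_mult mult lact ract (semidirect_mult mult lact ract x y) z =
      semidirect_mult mult lact ract x (semidirect_mult mult lact ract y z)" for x y z
    \<comment> \<open>Additivity of the actions opens the nested sums, so that the terms can be
      matched one by one.\<close>
    using lact_bilinear ract_bilinear
    by (auto simp: semidirect_mult_def bilinear_map_iff alg.mult_assoc lact_lact lact_ract
        ract_ract add.assoc split: prod.splits)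
qed

context relative_averaging_bimodule
begin

text \<open>For each of the three action laws, an entry from \<open>N\<close> calls for a bimodule
  axiom of \<open>N\<close>, and an entry from \<open>B\<close> in either algebra factor calls for
  one of the six compatibilities of \<open>l\<close> and \<open>r\<close>, two per law.\<close>

lemma semidirect_algebra_bimodule:
  "algebra_bimodule (module_prod.scale sA sB) (semidirect_mult mult lB rB)
     (module_prod.scale sM sN) (semidirect_lact lM lN r) (semidirect_ract rM rN l)"
proof (intro algebra_bimodule.intro algebra_bimodule_axioms.intro B.semidirect_assoc_algebra)
  show "vector_space (module_prod.scale sM sN)"
    by (intro vector_space_prod_scale vs.vector_space_axioms N.vs.vector_space_axioms)
  show "bilinear_map (module_prod.scale sA sB) (module_prod.scale sM sN) (module_prod.scale sM sN)
      (semidirect_lact lM lN r)"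
    unfolding semidirect_lact_def
    by (intro bilinear_map_prod lact_bilinear N.lact_bilinear r_bilinear)
  show "bilinear_map (module_prod.scale sM sN) (module_prod.scale sA sB) (module_prod.scale sM sN)
      (semidirect_ract rM rN l)"
    unfolding semidirect_ract_def
    by (intro bilinear_map_prod ract_bilinear l_bilinear N.ract_bilinear)
  show "semidirect_lact lM lN r (semidirect_mult mult lB rB x y) w =
      semidirect_lact lM lN r x (semidirect_lact lM lN r y w)" for x y w
    using N.lact_bilinear r_bilinear
    by (auto simp: semidirect_mult_def semidirect_lact_def bilinear_map_iff lact_lact N.lact_lact
        r_lB r_rB add.assoc split: prod.splits)
  show "semidirect_ract rM rN l (semidirect_lact lM lN r x w) y =
      semidirect_lact lM lN r x (semidirect_ract rM rN l w y)" for x y w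
    using N.lact_bilinear N.ract_bilinear
    by (auto simp: semidirect_lact_def semidirect_ract_def bilinear_map_iff lact_ract N.lact_ract
        l_lM r_rM add.assoc split: prod.splits)
  show "semidirect_ract rM rN l w (semidirect_mult mult lB rB x y) =
      semidirect_ract rM rN l (semidirect_ract rM rN l w x) y" for x y w
    using N.ract_bilinear l_bilinear
    by (auto simp: semidirect_mult_def semidirect_ract_def bilinear_map_iff ract_ract N.ract_ract
        l_rM l_rB add.assoc split: prod.splits)
qed

text \<open>The product of two images has second component
  \<open>lB (P u) (Q m) + rB (Q n) (P v)\<close>. Each summand is a value of \<open>Q\<close> in two
  ways: \<open>PQ_lN\<close> with \<open>QP_r\<close> gives the left averaging law,
  \<open>PQ_l\<close> with \<open>QP_rN\<close> the right one.\<close>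

lemma semidirect_relative_averaging_algebra:
  "relative_averaging_algebra (module_prod.scale sA sB) (semidirect_mult mult lB rB)
     (module_prod.scale sM sN) (semidirect_lact lM lN r) (semidirect_ract rM rN l) (map_prod P Q)"
proof (intro relative_averaging_algebra.intro relative_averaging_algebra_axioms.intro
    semidirect_algebra_bimodule linear_map_prod P_linear Q_linear)
  \<comment> \<open>Splits \<open>Q\<close> of the two-term second component of an action.\<close>
  have Q_add: "Q (m + n) = Q m + Q n" for m n
    using Q_linear by (simp add: Vector_Spaces.linear_iff)
  show "semidirect_mult mult lB rB (map_prod P Q v) (map_prod P Q w) =
      map_prod P Q (semidirect_lact lM lN r (map_prod P Q v) w)" for v w
    by (cases v; cases w) (simp add: semidirect_mult_def semidirect_lact_def Q_add P_lact PQ_lN QP_r)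
  show "semidirect_mult mult lB rB (map_prod P Q v) (map_prod P Q w) =
      map_prod P Q (semidirect_ract rM rN l v (map_prod P Q w))" for v w
    by (cases v; cases w) (simp add: semidirect_mult_def semidirect_ract_def Q_add P_ract PQ_l QP_rN)
qed

end

theorem theorem3p24:
  fixes sA :: "'k::field_char_0 \<Rightarrow> 'a::ab_group_add \<Rightarrow> 'a"
    and mult :: "'a \<Rightarrow> 'a \<Rightarrow> 'a"
    and sM :: "'k \<Rightarrow> 'm::ab_group_add \<Rightarrow> 'm"
    and lM :: "'a \<Rightarrow> 'm \<Rightarrow> 'm" and rM :: "'m \<Rightarrow> 'a \<Rightarrow> 'm"
    and P :: "'m \<Rightarrow> 'a"
    and sN :: "'k \<Rightarrow> 'n::ab_group_add \<Rightarrow> 'n"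
    and lN :: "'a \<Rightarrow> 'n \<Rightarrow> 'n" and rN :: "'n \<Rightarrow> 'a \<Rightarrow> 'n"
    and sB :: "'k \<Rightarrow> 'b::ab_group_add \<Rightarrow> 'b"
    and lB :: "'a \<Rightarrow> 'b \<Rightarrow> 'b" and rB :: "'b \<Rightarrow> 'a \<Rightarrow> 'b"
    and Q :: "'n \<Rightarrow> 'b"
    and l :: "'m \<Rightarrow> 'b \<Rightarrow> 'n" and r :: "'b \<Rightarrow> 'm \<Rightarrow> 'n"
  assumes "relative_averaging_algebra sA mult sM lM rM P"
    and "relative_averaging_bimodule sA mult sM lM rM P sN lN rN sB lB rB Q l r"
  shows "relative_averaging_algebra
           (module_prod.scale sA sB) (semidirect_mult mult lB rB)
           (module_prod.scale sM sN) (semidirect_lact lM lN r) (semidirect_ract rM rN l)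
           (map_prod P Q)"
  using assms(2) by (rule relative_averaging_bimodule.semidirect_relative_averaging_algebra)

end
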